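(* A finite ordered binary structure of type 1 is separable if and only if it does not embed any structure of $\mathcal{F}=A\cup B$. In other words, $\mathcal{S}_1=\mathrm{Forb}(\mathcal{F})$.
   Context: An ordered binary structure of type 1 is $(E,\le,\rho)$ with $\le$ a linear order and $\rho$ a binary relation on $E$; identify $\rho$ with its characteristic function and set $d(x,y):=(\rho(x,y),\rho(y,x))$. For two such structures $\mathcal{R}_1,\mathcal{R}_2$ on disjoint sets and a two-element structure $\mathcal{S}=(\{0,1\},\le,\sigma)$ with $0<1$, the sum $\mathcal{R}_1\oplus_{\mathcal{S}}\mathcal{R}_2$ is the structure on $V(\mathcal{R}_1)\cup V(\mathcal{R}_2)$ whose order puts all of $\mathcal{R}_1$ below all of $\mathcal{R}_2$ (and agrees with each order inside), whose relation agrees with $\mathcal{R}_j$'s relation inside $V(\mathcal{R}_j)$, and for $x\in V(\mathcal{R}_1)$, $y\in V(\mathcal{R}_2)$: $\rho(x,y)=\sigma(0,1)$, $\rho(y,x)=\sigma(1,0)$. The class $\mathcal{S}_1$ of separable structures is the smallest class containing the one-element structures (with $\rho$ reflexive or not at the point) and closed under the operations $(\mathcal{R}_1,\mathcal{R}_2)\mapsto\mathcal{R}_1\oplus_{\mathcal{S}}\mathcal{R}_2$ for every reflexive two-element ordered structure $\mathcal{S}$ of type 1, considered up to isomorphism. $A$ is the set of structures on $\{0,1,2\}$ with $0<1<2$ such that $d(0,1)\ne d(0,2)$ and $d(1,2)\ne d(0,2)$; $B$ is the set of structures on $\{0,1,2,3\}$ with $0<1<2<3$ such that $d(0,1)=d(0,3)=d(2,3)$,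 $d(1,2)=d(1,3)=d(0,2)$ and $d(0,1)\ne d(0,2)$ (the values $\rho(x,x)$ are arbitrary). Embedding means isomorphism onto a restriction; $\mathrm{Forb}(\mathcal{F})$ is the class of finite ordered binary structures of type 1 embedding no member of $\mathcal{F}$. *)

theory Defs
  imports Main
begin

record 'a obs =
  verts :: "'a set"
  le :: "('a \<times> 'a) set"
  rho :: "('a \<times> 'a) set"

text \<open>Both relations live on \<open>verts\<close> (for \<open>le\<close> this is part of \<open>linear_order_on\<close>), which makes equality of records equality of structures.
  The empty structure is allowed here.\<close>

definition ordered_binary_structure :: "'a obs \<Rightarrow> bool" where
  "ordered_binary_structure R \<longleftrightarrow>
     linear_order_on (verts R) (le R) \<and> rho R \<subseteq> verts R \<times> verts R"

definition d :: "'a obs \<Rightarrow> 'a \<Rightarrow> 'a \<Rightarrow> bool \<times> bool" where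
  "d R x y = ((x, y) \<in> rho R, (y, x) \<in> rho R)"

definition restriction :: "'a obs \<Rightarrow> 'a set \<Rightarrow> 'a obs" where
  "restriction R X =
     \<lparr>verts = verts R \<inter> X, le = le R \<inter> X \<times> X, rho = rho R \<inter> X \<times> X\<rparr>"

definition isomorphic :: "'a obs \<Rightarrow> 'b obs \<Rightarrow> bool" where
  "isomorphic R R' \<longleftrightarrow>
     (\<exists>f. bij_betw f (verts R) (verts R') \<and>
       (\<forall>x\<in>verts R. \<forall>y\<in>verts R.
          ((x, y) \<in> le R \<longleftrightarrow> (f x, f y) \<in> le R') \<and>
          ((x, y) \<in> rho R \<longleftrightarrow> (f x, f y) \<in> rho R')))"

definition embeds_in :: "'a obs \<Rightarrow> 'b obs \<Rightarrow> bool" where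
  "embeds_in S R \<longleftrightarrow> (\<exists>X \<subseteq> verts R. isomorphic S (restriction R X))"

definition Forb :: "'b obs set \<Rightarrow> 'a obs set" where
  "Forb \<F> = {R. ordered_binary_structure R \<and> finite (verts R) \<and> \<not> (\<exists>S\<in>\<F>. embeds_in S R)}"

definition structures_below :: "nat \<Rightarrow> nat obs set" where
  "structures_below n =
     {S. ordered_binary_structure S \<and> verts S = {..<n} \<and> le S = {(i, j). i \<le> j \<and> j < n}}"

definition reflexive_structure :: "'a obs \<Rightarrow> bool" where
  "reflexive_structure S \<longleftrightarrow> (\<forall>x\<in>verts S. (x, x) \<in> rho S)"

definition osum :: "nat obs \<Rightarrow> 'a obs \<Rightarrow> 'a obs \<Rightarrow> 'a obs" where
  "osum S R\<^sub>1 R\<^sub>2 =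
     \<lparr>verts = verts R\<^sub>1 \<union> verts R\<^sub>2,
      le = le R\<^sub>1 \<union> le R\<^sub>2 \<union> verts R\<^sub>1 \<times> verts R\<^sub>2,
      rho = rho R\<^sub>1 \<union> rho R\<^sub>2 \<union>
        {(x, y). x \<in> verts R\<^sub>1 \<and> y \<in> verts R\<^sub>2 \<and> (0, 1) \<in> rho S} \<union>
        {(y, x). x \<in> verts R\<^sub>1 \<and> y \<in> verts R\<^sub>2 \<and> (1, 0) \<in> rho S}\<rparr>"

text \<open>The class is formed inside an arbitrary universe \<open>'a\<close>. This loses nothing, since the summands
  of a sum are restrictions of it, so every construction of a structure can be carried out on
  subsets of its own domain. The empty structure is not a member.\<close>

inductive_set separable_class :: "'a obs set" where
  one: "\<lbrakk>ordered_binary_structure R; verts R = {x}\<rbrakk> \<Longrightarrow> R \<in> separable_class"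
| sum: "\<lbrakk>R\<^sub>1 \<in> separable_class; R\<^sub>2 \<in> separable_class; verts R\<^sub>1 \<inter> verts R\<^sub>2 = {};
         S \<in> structures_below 2; reflexive_structure S\<rbrakk> \<Longrightarrow> osum S R\<^sub>1 R\<^sub>2 \<in> separable_class"
| iso: "\<lbrakk>R \<in> separable_class; ordered_binary_structure R'; isomorphic R R'\<rbrakk> \<Longrightarrow> R' \<in> separable_class"

definition class_A :: "nat obs set" where
  "class_A = {S \<in> structures_below 3. d S 0 1 \<noteq> d S 0 2 \<and> d S 1 2 \<noteq> d S 0 2}"

definition class_B :: "nat obs set" where
  "class_B = {S \<in> structures_below 4.
     d S 0 1 = d S 0 3 \<and> d S 0 3 = d S 2 3 \<and>
     d S 1 2 = d S 1 3 \<and> d S 1 3 = d S 0 2 \<and>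
     d S 0 1 \<noteq> d S 0 2}"

end

theory Submission
  imports Defs
begin

text \<open>
  A structure with more than one point is separable iff it has a cut \<open>I < J\<close> across which \<open>d\<close>
  is constant and both sides are separable. A pattern from \<open>A \<union> B\<close> cannot cross such a cut, so
  separable structures avoid these patterns. Conversely, avoidance passes to restrictions, so it
  suffices to find one cut, by induction on the number of points. Remove the last point \<open>m\<close> and
  take a cut \<open>I < J\<close> with colour \<open>p\<close> of the rest. If some \<open>x \<in> I\<close> has \<open>d x m = q \<noteq> p\<close>, then
  avoiding \<open>A\<close> forces \<open>d y m = q\<close> for all \<open>y \<in> J\<close>, hence \<open>d z m \<in> {p, q}\<close> for all \<open>z \<in> I\<close>.
  If both colours occur on \<open>I\<close>, avoiding \<open>A\<close> and \<open>B\<close> puts the points of colour \<open>p\<close>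
  before those of colour \<open>q\<close>, and the former are the lower part of a cut of colour \<open>p\<close>.
\<close>

section \<open>Pattern avoidance and cuts for coloured orders\<close>

text \<open>Phrased for a bare relation and a colouring of pairs, so that the vertex set can shrink
  or be split while \<open>s\<close> and \<open>c\<close> stay fixed. When \<open>s\<close> is a
  strict order, only pairs of distinct points are inspected, in accordance with the arbitrary
  diagonal values in \<open>class_A\<close>.\<close>

definition A_free :: "('a \<times> 'a) set \<Rightarrow> ('a \<Rightarrow> 'a \<Rightarrow> 'c) \<Rightarrow> 'a set \<Rightarrow> bool" where
  "A_free s c V \<longleftrightarrow>
     (\<forall>x\<in>V. \<forall>y\<in>V. \<forall>z\<in>V. (x, y) \<in> s \<longrightarrow> (y, z) \<in> s \<longrightarrow> c x z = c x y \<or> c x z = c y z)"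

text \<open>The colour premises are the equalities of \<open>class_B\<close>, with \<open>w\<close>,
  \<open>x\<close>, \<open>y\<close>, \<open>z\<close> in the roles of 0, 1, 2, 3; the conclusion
  denies its inequality.\<close>

definition B_free :: "('a \<times> 'a) set \<Rightarrow> ('a \<Rightarrow> 'a \<Rightarrow> 'c) \<Rightarrow> 'a set \<Rightarrow> bool" where
  "B_free s c V \<longleftrightarrow>
     (\<forall>w\<in>V. \<forall>x\<in>V. \<forall>y\<in>V. \<forall>z\<in>V. (w, x) \<in> s \<longrightarrow> (x, y) \<in> s \<longrightarrow> (y, z) \<in> s \<longrightarrow>
        c w x = c w z \<longrightarrow> c w z = c y z \<longrightarrow> c x y = c x z \<longrightarrow> c x z = c w y \<longrightarrow> c w x = c w y)"

text \<open>The trace of a sum on its vertex set: for \<open>c = d R\<close>, the colour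
  \<open>p\<close> is the pair of values \<sigma>(0,1), \<sigma>(1,0) of the two-element
  structure.\<close>

definition cut :: "('a \<times> 'a) set \<Rightarrow> ('a \<Rightarrow> 'a \<Rightarrow> 'c) \<Rightarrow> 'a set \<Rightarrow> 'a set \<Rightarrow> 'a set \<Rightarrow> 'c \<Rightarrow> bool" where
  "cut s c V I J p \<longleftrightarrow> I \<noteq> {} \<and> J \<noteq> {} \<and> I \<inter> J = {} \<and> V = I \<union> J \<and>
     (\<forall>x\<in>I. \<forall>y\<in>J. (x, y) \<in> s \<and> c x y = p)"

abbreviation slt :: "'a obs \<Rightarrow> ('a \<times> 'a) set" where
  "slt R \<equiv> le R - Id"

lemma A_free_subset: "A_free s c V \<Longrightarrow> W \<subseteq> V \<Longrightarrow> A_free s c W"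
  unfolding A_free_def by (meson subsetD)

lemma B_free_subset: "B_free s c V \<Longrightarrow> W \<subseteq> V \<Longrightarrow> B_free s c W"
  unfolding B_free_def by (meson subsetD)

text \<open>Serves to transfer avoidance along isomorphisms and, with \<open>f\<close> the identity,
  to compare a structure with its restrictions and summands.\<close>

lemma A_free_cong:
  assumes "\<And>x y. x \<in> V \<Longrightarrow> y \<in> V \<Longrightarrow> ((f x, f y) \<in> s' \<longleftrightarrow> (x, y) \<in> s) \<and> c' (f x) (f y) = c x y"
  shows "A_free s' c' (f ` V) \<longleftrightarrow> A_free s c V"
  using assms unfolding A_free_def by simp

lemma B_free_cong:
  assumes "\<And>x y. x \<in> V \<Longrightarrow> y \<in> V \<Longrightarrow> ((f x, f y) \<in> s' \<longleftrightarrow> (x, y) \<in> s) \<and> c' (f x) (f y) = c x y"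
  shows "B_free s' c' (f ` V) \<longleftrightarrow> B_free s c V"
  using assms unfolding B_free_def by simp

section \<open>Existence of cuts\<close>

lemma finite_total_has_max:
  assumes "finite V" "V \<noteq> {}" "trans s" "total_on V s"
  shows "\<exists>m\<in>V. \<forall>x\<in>V - {m}. (x, m) \<in> s"
  using assms
proof (induction rule: finite_ne_induct)
  case (singleton x)
  then show ?case by simp
next
  case (insert x F)
  have "total_on F s"
    using insert.prems(2) by (auto simp: total_on_def)
  then obtain m where m: "m \<in> F" "\<forall>x\<in>F - {m}. (x, m) \<in> s"
    using insert by blast
  then have "(x, m) \<in> s \<or> (m, x) \<in> s"
    using insert by (auto simp: total_on_def)
  then show ?case
  proof
    assume "(x, m) \<in> s"
    then show ?thesis using m by blast
  next
    assume "(m, x) \<in> s"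
    then have "\<forall>y\<in>insert x F - {x}. (y, x) \<in> s"
      using m transD[OF \<open>trans s\<close>] by blast
    then show ?thesis by blast
  qed
qed

text \<open>Three cuts can arise: \<open>m\<close> joins \<open>J\<close>, or \<open>m\<close> alone
  is the upper part, or the lower part shrinks to the points of \<open>I\<close> that have colour
  \<open>p\<close> towards \<open>m\<close>.\<close>

lemma cut_insert_max:
  assumes cut: "cut s c V I J p" and m: "m \<notin> V" "\<forall>x\<in>V. (x, m) \<in> s"
    and tot: "total_on V s"
    and A: "A_free s c (insert m V)" and B: "B_free s c (insert m V)"
  shows "\<exists>I J p. cut s c (insert m V) I J p"
proof -
  have IJ: "I \<noteq> {}" "J \<noteq> {}" "I \<inter> J = {}" "V = I \<union> J"
    and between: "\<And>x y. x \<in> I \<Longrightarrow> y \<in> J \<Longrightarrow> (x, y) \<in> s"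
    and col: "\<And>x y. x \<in> I \<Longrightarrow> y \<in> J \<Longrightarrow> c x y = p"
    using cut unfolding cut_def by auto
  have last: "c x m = c x y \<or> c x m = c y m" if "x \<in> V" "y \<in> V" "(x, y) \<in> s" for x y
    using A that m unfolding A_free_def by blast
  show ?thesis
  proof (cases "\<forall>x\<in>I. c x m = p")
    case True
    have "cut s c (insert m V) I (insert m J) p"
      unfolding cut_def using True IJ between col m by auto
    then show ?thesis by blast
  next
    case False
    then obtain x0 where x0: "x0 \<in> I" "c x0 m \<noteq> p" by blast
    define q where "q = c x0 m"
    \<comment> \<open>In the triple \<open>x0\<close>, \<open>y\<close>, \<open>m\<close> the outer
      colour \<open>q\<close> differs from \<open>c x0 y = p\<close>, so it must equal
      \<open>c y m\<close>.\<close>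
    have Jq: "c y m = q" if "y \<in> J" for y
      using last[of x0 y] x0 that IJ between col unfolding q_def by auto
    obtain y0 where y0: "y0 \<in> J" using IJ by blast
    \<comment> \<open>In the triple \<open>x\<close>, \<open>y0\<close>, \<open>m\<close> the two
      inner colours are \<open>p\<close> and \<open>q\<close>.\<close>
    have Ipq: "c x m = p \<or> c x m = q" if "x \<in> I" for x
      using last[of x y0] that y0 Jq IJ between col by auto
    define P where "P = {x \<in> I. c x m = p}"
    show ?thesis
    proof (cases "P = {}")
      case True
      have "cut s c (insert m V) V {m} q"
        unfolding cut_def using True IJ m Jq Ipq unfolding P_def by auto
      then show ?thesis by blast
    next
      case False
      have PQ: "(x, y) \<in> s \<and> c x y = p" if x: "x \<in> P" and y: "y \<in> I - P" for x y
      proof -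
        have xy: "x \<in> V" "y \<in> V" "x \<in> I" "y \<in> I" "c x m = p" "c y m = q" "x \<noteq> y"
          using x y Ipq IJ by (auto simp: P_def)
        have pq: "p \<noteq> q" using x0 by (simp add: q_def)
        have "(y, x) \<notin> s"
        proof
          assume yx: "(y, x) \<in> s"
          \<comment> \<open>The outer colour of the triple \<open>y\<close>, \<open>x\<close>,
            \<open>m\<close> is \<open>q\<close>, whereas \<open>c x m = p\<close>.\<close>
          then have "c y x = q" using last[of y x] xy pq by auto
          \<comment> \<open>The points \<open>y < x < y0 < m\<close> form a pattern from \<open>B\<close>.\<close>
          moreover have "c y y0 = p" "c x y0 = p" "c y0 m = q" "(x, y0) \<in> s" "(y0, m) \<in> s" "y0 \<in> V"
            using xy y0 col Jq between m IJ by auto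
          moreover have "c y x = c y m \<longrightarrow> c y m = c y0 m \<longrightarrow> c x y0 = c x m \<longrightarrow> c x m = c y y0
              \<longrightarrow> c y x = c y y0"
            using B yx calculation(5,6,7) xy(1,2) unfolding B_free_def by blast
          ultimately show False using xy pq by simp
        qed
        then have "(x, y) \<in> s" using tot xy by (auto simp: total_on_def)
        \<comment> \<open>Now the triple is \<open>x\<close>, \<open>y\<close>, \<open>m\<close>,
          with outer colour \<open>p\<close> and \<open>c y m = q\<close>, which leaves
          \<open>c x y = p\<close>.\<close>
        then show ?thesis using last[of x y] xy pq by auto
      qed
      \<comment> \<open>Points above \<open>P\<close> are of three kinds: those of
        \<open>I - P\<close> are covered by \<open>PQ\<close>, those of \<open>J\<close> by the
        given cut, and \<open>m\<close> by the choice of \<open>P\<close>.\<close>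
      have "cut s c (insert m V) P (insert m ((I - P) \<union> J)) p"
        unfolding cut_def
      proof (intro conjI ballI)
        fix x y assume x: "x \<in> P" and y: "y \<in> insert m ((I - P) \<union> J)"
        have xI: "x \<in> I" "c x m = p" using x by (auto simp: P_def)
        show "(x, y) \<in> s" "c x y = p"
          using y xI PQ[OF x, of y] between[of x y] col[of x y] m IJ by (elim insertE UnE; simp)+
      qed (use False IJ m in \<open>auto simp: P_def\<close>)
      then show ?thesis by blast
    qed
  qed
qed

text \<open>Induction by removing the maximum. It stops at two points, where the two singletons form
  a cut whose colour is that of the only pair.\<close>

lemma exists_cut:
  assumes "finite V" "2 \<le> card V" "trans s" "total_on V s" "A_free s c V" "B_free s c V"
  shows "\<exists>I J p. cut s c V I J p"
  using assms
proof (induction V rule: finite_psubset_induct)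
  case (psubset V)
  have "V \<noteq> {}" using psubset.prems by auto
  then obtain m where m: "m \<in> V" "\<forall>x\<in>V - {m}. (x, m) \<in> s"
    using finite_total_has_max psubset by metis
  define W where "W = V - {m}"
  have V: "V = insert m W" "m \<notin> W" "\<forall>x\<in>W. (x, m) \<in> s" using m by (auto simp: W_def)
  have tot: "total_on W s" using psubset.prems V by (auto simp: total_on_def)
  have cW: "card V = Suc (card W)" "finite W" using V psubset.hyps by auto
  show ?case
  proof (cases "2 \<le> card W")
    case True
    have "\<exists>I J p. cut s c W I J p"
      using psubset.IH[of W] True tot V psubset.prems A_free_subset[of s c V W]
        B_free_subset[of s c V W] by blast
    then show ?thesis
      using cut_insert_max V tot psubset.prems by metis
  next
    case False
    then have "card W = 1" using cW psubset.prems by simp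
    then obtain x where "W = {x}" by (auto simp: card_1_singleton_iff)
    then have "cut s c V {x} {m} (c x m)" using V by (auto simp: cut_def)
    then show ?thesis by blast
  qed
qed

section \<open>Embeddings of small structures as increasing chains\<close>

lemma slt_strict:
  assumes "ordered_binary_structure R"
  shows "trans (slt R)" "irrefl (slt R)" "total_on (verts R) (slt R)" "slt R \<subseteq> verts R \<times> verts R"
  using assms strict_linear_order_on_diff_Id[of "verts R" "le R"]
  unfolding ordered_binary_structure_def strict_linear_order_on_def linear_order_on_def
    partial_order_on_def preorder_on_def by auto

lemma le_conv_slt:
  assumes "ordered_binary_structure R" "x \<in> verts R"
  shows "(x, y) \<in> le R \<longleftrightarrow> x = y \<or> (x, y) \<in> slt R"
  using assms
  by (auto simp: ordered_binary_structure_def order_on_defs refl_on_def)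

lemma slt_asym:
  assumes "ordered_binary_structure R" "(x, y) \<in> slt R"
  shows "(y, x) \<notin> slt R"
  using slt_strict(1,2)[OF assms(1)] assms(2) by (meson irrefl_def transD)

text \<open>A strictly increasing map between linear orders is injective and reflects the order, so
  beyond monotonicity only \<open>rho\<close> has to be matched.\<close>

lemma embeds_in_structures_below:
  assumes S: "S \<in> structures_below n" and R: "ordered_binary_structure R"
  shows "embeds_in S R \<longleftrightarrow>
    (\<exists>f. (\<forall>i<n. f i \<in> verts R) \<and> (\<forall>i<n. \<forall>j<n. i < j \<longrightarrow> (f i, f j) \<in> slt R) \<and>
         (\<forall>i<n. \<forall>j<n. (i, j) \<in> rho S \<longleftrightarrow> (f i, f j) \<in> rho R))" (is "_ = ?R")
proof
  assume "embeds_in S R"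
  then obtain X f where X: "X \<subseteq> verts R" and f: "bij_betw f {..<n} X"
    and iso: "\<And>i j. i < n \<Longrightarrow> j < n \<Longrightarrow> (i \<le> j \<longleftrightarrow> (f i, f j) \<in> le R \<inter> X \<times> X) \<and>
      ((i, j) \<in> rho S \<longleftrightarrow> (f i, f j) \<in> rho R \<inter> X \<times> X)"
    using S unfolding embeds_in_def isomorphic_def structures_below_def restriction_def
    by (auto simp: Int_absorb1)
  have "f i \<in> X" if "i < n" for i using f that by (auto simp: bij_betw_def)
  moreover have "f i \<noteq> f j" if "i < j" "j < n" for i j
    using f that by (auto simp: bij_betw_def inj_on_def)
  ultimately have "(\<forall>i<n. f i \<in> verts R) \<and> (\<forall>i<n. \<forall>j<n. i < j \<longrightarrow> (f i, f j) \<in> slt R) \<and>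
         (\<forall>i<n. \<forall>j<n. (i, j) \<in> rho S \<longleftrightarrow> (f i, f j) \<in> rho R)"
    using X iso by (simp add: subset_iff) (metis less_imp_le)
  then show ?R by blast
next
  assume ?R
  then obtain f where f: "\<forall>i<n. f i \<in> verts R" "\<forall>i<n. \<forall>j<n. i < j \<longrightarrow> (f i, f j) \<in> slt R"
    "\<forall>i<n. \<forall>j<n. (i, j) \<in> rho S \<longleftrightarrow> (f i, f j) \<in> rho R"
    by blast
  have fv: "f i \<in> verts R" if "i < n" for i
    using f(1) that by blast
  have fl: "(f i, f j) \<in> slt R" if "i < j" "j < n" for i j
    using f(2) that less_trans by blast
  have fr: "(i, j) \<in> rho S \<longleftrightarrow> (f i, f j) \<in> rho R" if "i < n" "j < n" for i j
    using f(3) that by blast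
  have inj: "inj_on f {..<n}"
  proof (rule linorder_inj_onI)
    fix i j :: nat assume "i < j" "j \<in> {..<n}"
    then show "f i \<noteq> f j" using fl[of i j] by auto
  qed auto
  have le: "i \<le> j \<longleftrightarrow> (f i, f j) \<in> le R" if ij: "i < n" "j < n" for i j
  proof (cases i j rule: linorder_cases)
    case less
    then show ?thesis using fl[of i j] ij by auto
  next
    case equal
    then show ?thesis using le_conv_slt[OF R fv[OF ij(1)], of "f j"] by blast
  next
    case greater
    then have "(f i, f j) \<notin> slt R" "f i \<noteq> f j" using fl[of j i] slt_asym[OF R] ij by auto
    then show ?thesis using greater by auto
  qed
  have "verts S = {..<n}" "le S = {(i, j). i \<le> j \<and> j < n}"
    using S by (auto simp: structures_below_def)
  moreover have "verts R \<inter> f ` {..<n} = f ` {..<n}" using fv by auto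
  ultimately have "bij_betw f (verts S) (verts (restriction R (f ` {..<n}))) \<and>
      (\<forall>i\<in>verts S. \<forall>j\<in>verts S.
        ((i, j) \<in> le S \<longleftrightarrow> (f i, f j) \<in> le (restriction R (f ` {..<n}))) \<and>
        ((i, j) \<in> rho S \<longleftrightarrow> (f i, f j) \<in> rho (restriction R (f ` {..<n}))))"
    using inj le fr by (simp add: restriction_def bij_betw_def)
  then have "isomorphic S (restriction R (f ` {..<n}))"
    unfolding isomorphic_def by blast
  then show "embeds_in S R" unfolding embeds_in_def using fv by (intro exI[of _ "f ` {..<n}"]) auto
qed

text \<open>Pull \<open>rho\<close> back along the chain, diagonal included. As
  \<open>class_A\<close> and \<open>class_B\<close> contain every structure with the prescribed
  \<open>d\<close> between distinct points, a chain in \<open>R\<close> with these values yields an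
  embedded member.\<close>

lemma ex_pulled_back_structure:
  assumes R: "ordered_binary_structure R"
    and fv: "\<And>i. i < n \<Longrightarrow> f i \<in> verts R" and fl: "\<And>i j. i < j \<Longrightarrow> j < n \<Longrightarrow> (f i, f j) \<in> slt R"
  shows "\<exists>S \<in> structures_below n. embeds_in S R \<and> (\<forall>i<n. \<forall>j<n. d S i j = d R (f i) (f j))"
proof -
  define S where "S = \<lparr>verts = {..<n}, le = {(i, j). i \<le> j \<and> j < n},
     rho = {(i, j). i < n \<and> j < n \<and> (f i, f j) \<in> rho R}\<rparr>"
  have S: "S \<in> structures_below n"
    unfolding S_def structures_below_def ordered_binary_structure_def
    by (auto simp: linear_order_on_def partial_order_on_def preorder_on_def refl_on_def
        trans_def antisym_def total_on_def)
  moreover have "embeds_in S R"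
    unfolding embeds_in_structures_below[OF S R] using fv fl
    by (intro exI[of _ f]) (auto simp: S_def)
  ultimately show ?thesis by (intro bexI[of _ S]) (auto simp: S_def d_def)
qed

lemma embeds_class_A_iff:
  assumes R: "ordered_binary_structure R"
  shows "(\<exists>S\<in>class_A. embeds_in S R) \<longleftrightarrow> \<not> A_free (slt R) (d R) (verts R)"
proof
  assume "\<exists>S\<in>class_A. embeds_in S R"
  then obtain S where S: "S \<in> structures_below 3" "embeds_in S R"
    "d S 0 1 \<noteq> d S 0 2" "d S 1 2 \<noteq> d S 0 2"
    unfolding class_A_def by auto
  obtain f where f: "\<forall>i<3. f i \<in> verts R" "\<forall>i<3. \<forall>j<3. i < j \<longrightarrow> (f i, f j) \<in> slt R"
    "\<forall>i<3. \<forall>j<3. (i, j) \<in> rho S \<longleftrightarrow> (f i, f j) \<in> rho R"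
    using embeds_in_structures_below[OF S(1) R] S(2) by blast
  have d: "d S i j = d R (f i) (f j)" if "i < 3" "j < 3" for i j
    using f(3) that by (simp add: d_def)
  have "f 0 \<in> verts R" "f 1 \<in> verts R" "f 2 \<in> verts R"
    "(f 0, f 1) \<in> slt R" "(f 1, f 2) \<in> slt R"
    using f(1) f(2)[rule_format, of 0 1] f(2)[rule_format, of 1 2] by auto
  moreover have "d R (f 0) (f 1) \<noteq> d R (f 0) (f 2)" "d R (f 1) (f 2) \<noteq> d R (f 0) (f 2)"
    using S(3,4) by (simp_all add: d)
  ultimately show "\<not> A_free (slt R) (d R) (verts R)"
    unfolding A_free_def by metis
next
  assume "\<not> A_free (slt R) (d R) (verts R)"
  then obtain x y z where xyz: "x \<in> verts R" "y \<in> verts R" "z \<in> verts R"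
    "(x, y) \<in> slt R" "(y, z) \<in> slt R" "d R x z \<noteq> d R x y" "d R x z \<noteq> d R y z"
    unfolding A_free_def by blast
  have xz: "(x, z) \<in> slt R" using xyz transD[OF slt_strict(1)[OF R]] by blast
  \<comment> \<open>List indexing turns the chain into a map on the indices 0, 1, 2.\<close>
  let ?f = "(!) [x, y, z]"
  have "?f i \<in> verts R" if "i < 3" for i
    using that xyz by (auto simp: less_Suc_eq numeral_eq_Suc)
  moreover have "(?f i, ?f j) \<in> slt R" if "i < j" "j < 3" for i j
    using that xyz xz by (auto simp: less_Suc_eq numeral_eq_Suc)
  ultimately obtain S where S: "S \<in> structures_below 3" "embeds_in S R"
    "\<forall>i<3. \<forall>j<3. d S i j = d R (?f i) (?f j)"
    using ex_pulled_back_structure[OF R, of 3 ?f] by blast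
  then have "S \<in> class_A" using xyz unfolding class_A_def by simp
  then show "\<exists>S\<in>class_A. embeds_in S R" using S by blast
qed

lemma embeds_class_B_iff:
  assumes R: "ordered_binary_structure R"
  shows "(\<exists>S\<in>class_B. embeds_in S R) \<longleftrightarrow> \<not> B_free (slt R) (d R) (verts R)"
proof
  assume "\<exists>S\<in>class_B. embeds_in S R"
  then obtain S where S: "S \<in> structures_below 4" "embeds_in S R"
    and dS: "d S 0 1 = d S 0 3" "d S 0 3 = d S 2 3" "d S 1 2 = d S 1 3" "d S 1 3 = d S 0 2"
     "d S 0 1 \<noteq> d S 0 2"
    unfolding class_B_def by auto
  obtain f where f: "\<forall>i<4. f i \<in> verts R" "\<forall>i<4. \<forall>j<4. i < j \<longrightarrow> (f i, f j) \<in> slt R"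
    "\<forall>i<4. \<forall>j<4. (i, j) \<in> rho S \<longleftrightarrow> (f i, f j) \<in> rho R"
    using embeds_in_structures_below[OF S(1) R] S(2) by blast
  have d: "d S i j = d R (f i) (f j)" if "i < 4" "j < 4" for i j
    using f(3) that by (simp add: d_def)
  have "f 0 \<in> verts R" "f 1 \<in> verts R" "f 2 \<in> verts R" "f 3 \<in> verts R"
    "(f 0, f 1) \<in> slt R" "(f 1, f 2) \<in> slt R" "(f 2, f 3) \<in> slt R"
    using f(1) f(2)[rule_format, of 0 1] f(2)[rule_format, of 1 2] f(2)[rule_format, of 2 3] by auto
  moreover have "d R (f 0) (f 1) = d R (f 0) (f 3)" "d R (f 0) (f 3) = d R (f 2) (f 3)"
    "d R (f 1) (f 2) = d R (f 1) (f 3)" "d R (f 1) (f 3) = d R (f 0) (f 2)"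
    "d R (f 0) (f 1) \<noteq> d R (f 0) (f 2)"
    using dS by (simp_all add: d)
  ultimately show "\<not> B_free (slt R) (d R) (verts R)"
    unfolding B_free_def by blast
next
  assume "\<not> B_free (slt R) (d R) (verts R)"
  then obtain w x y z where wxyz: "w \<in> verts R" "x \<in> verts R" "y \<in> verts R" "z \<in> verts R"
    "(w, x) \<in> slt R" "(x, y) \<in> slt R" "(y, z) \<in> slt R"
    and dR: "d R w x = d R w z" "d R w z = d R y z" "d R x y = d R x z" "d R x z = d R w y"
    "d R w x \<noteq> d R w y"
    unfolding B_free_def by blast
  \<comment> \<open>A chain of four points has six increasing pairs; transitivity supplies the three
    that are not consecutive.\<close>
  have more: "(w, y) \<in> slt R" "(x, z) \<in> slt R" "(w, z) \<in> slt R"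
    using wxyz transD[OF slt_strict(1)[OF R]] by blast+
  let ?f = "(!) [w, x, y, z]"
  have "?f i \<in> verts R" if "i < 4" for i
    using that wxyz by (auto simp: less_Suc_eq numeral_eq_Suc)
  moreover have "(?f i, ?f j) \<in> slt R" if "i < j" "j < 4" for i j
    using that wxyz more by (auto simp: less_Suc_eq numeral_eq_Suc)
  ultimately obtain S where S: "S \<in> structures_below 4" "embeds_in S R"
    "\<forall>i<4. \<forall>j<4. d S i j = d R (?f i) (?f j)"
    using ex_pulled_back_structure[OF R, of 4 ?f] by blast
  then have "S \<in> class_B" using dR unfolding class_B_def by simp
  then show "\<exists>S\<in>class_B. embeds_in S R" using S by blast
qed

section \<open>Separability of pattern-free structures\<close>

lemma restriction_ordered:
  assumes "ordered_binary_structure R"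
  shows "ordered_binary_structure (restriction R X)"
proof -
  have 1: "le R \<subseteq> verts R \<times> verts R" "refl_on (verts R) (le R)" "trans (le R)" "antisym (le R)"
    "total_on (verts R) (le R)" "rho R \<subseteq> verts R \<times> verts R"
    using assms unfolding ordered_binary_structure_def order_on_defs by auto
  have "le R \<inter> X \<times> X \<subseteq> (verts R \<inter> X) \<times> (verts R \<inter> X)" "rho R \<inter> X \<times> X \<subseteq> (verts R \<inter> X) \<times> (verts R \<inter> X)"
    using 1 by auto
  moreover have "refl_on (verts R \<inter> X) (le R \<inter> X \<times> X)" "total_on (verts R \<inter> X) (le R \<inter> X \<times> X)"
    using 1 by (auto simp: refl_on_def total_on_def)
  moreover have "trans (le R \<inter> X \<times> X)"
    by (rule transI) (use 1 in \<open>blast dest: transD\<close>)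
  moreover have "antisym (le R \<inter> X \<times> X)"
    using 1 by (meson antisym_subset inf_le1)
  ultimately show ?thesis
    unfolding ordered_binary_structure_def restriction_def order_on_defs by simp
qed

lemma pattern_free_restriction:
  assumes "A_free (slt R) (d R) (verts R)" "B_free (slt R) (d R) (verts R)"
  shows "A_free (slt (restriction R X)) (d (restriction R X)) (verts (restriction R X))"
    "B_free (slt (restriction R X)) (d (restriction R X)) (verts (restriction R X))"
proof -
  let ?Q = "restriction R X"
  have 1: "((x, y) \<in> slt ?Q \<longleftrightarrow> (x, y) \<in> slt R) \<and> d ?Q x y = d R x y"
    if "x \<in> verts ?Q" "y \<in> verts ?Q" for x y
    using that by (simp add: d_def restriction_def)
  have "verts ?Q \<subseteq> verts R" by (simp add: restriction_def)
  then show "A_free (slt ?Q) (d ?Q) (verts ?Q)" "B_free (slt ?Q) (d ?Q) (verts ?Q)"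
    using A_free_cong[of "verts ?Q" "\<lambda>x. x", OF 1] B_free_cong[of "verts ?Q" "\<lambda>x. x", OF 1]
      A_free_subset[OF assms(1)] B_free_subset[OF assms(2)] by simp_all
qed

text \<open>Inside each part the restrictions keep everything, and across the cut both relations are
  determined by \<open>p\<close>. Hence \<open>R\<close> is recovered as an equal record, not merely
  up to isomorphism.\<close>

lemma osum_restriction_cut:
  assumes R: "ordered_binary_structure R" and cut: "cut (slt R) (d R) (verts R) I J p"
  shows "\<exists>S \<in> structures_below 2. reflexive_structure S \<and>
    R = osum S (restriction R I) (restriction R J)"
proof -
  \<comment> \<open>The components of \<open>p\<close> govern the pairs (0,1) and (1,0). On the
    diagonal both implications are vacuous, which makes \<open>S\<close> reflexive.\<close>
  define S :: "nat obs" where "S = \<lparr>verts = {..<2}, le = {(i, j). i \<le> j \<and> j < 2},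
     rho = {(i, j). i < 2 \<and> j < 2 \<and> (i < j \<longrightarrow> fst p) \<and> (j < i \<longrightarrow> snd p)}\<rparr>"
  have S: "S \<in> structures_below 2" "reflexive_structure S"
    unfolding S_def structures_below_def ordered_binary_structure_def reflexive_structure_def
    by (auto simp: linear_order_on_def partial_order_on_def preorder_on_def refl_on_def
        trans_def antisym_def total_on_def)
  have S01: "(0, 1) \<in> rho S \<longleftrightarrow> fst p" "(1, 0) \<in> rho S \<longleftrightarrow> snd p" by (auto simp: S_def)
  have IJ: "verts R = I \<union> J" "I \<inter> J = {}"
    and lt: "\<And>x y. x \<in> I \<Longrightarrow> y \<in> J \<Longrightarrow> (x, y) \<in> slt R"
    and col: "\<And>x y. x \<in> I \<Longrightarrow> y \<in> J \<Longrightarrow> d R x y = p"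
    using cut unfolding cut_def by auto
  have leV: "le R \<subseteq> (I \<union> J) \<times> (I \<union> J)" "rho R \<subseteq> (I \<union> J) \<times> (I \<union> J)"
    using R IJ unfolding ordered_binary_structure_def order_on_defs by auto
  have nle: "(y, x) \<notin> le R" if "x \<in> I" "y \<in> J" for x y
    using slt_asym[OF R lt[OF that]] that IJ by auto
  have rho: "(x, y) \<in> rho R \<longleftrightarrow> fst p" "(y, x) \<in> rho R \<longleftrightarrow> snd p" if "x \<in> I" "y \<in> J" for x y
    using col[OF that] by (auto simp: d_def)
  have "le R = le R \<inter> I \<times> I \<union> le R \<inter> J \<times> J \<union> I \<times> J"
    using leV lt nle by blast
  moreover have "rho R = rho R \<inter> I \<times> I \<union> rho R \<inter> J \<times> J \<union> {(x, y). x \<in> I \<and> y \<in> J \<and> fst p} \<union>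
      {(y, x). x \<in> I \<and> y \<in> J \<and> snd p}"
    using leV(2) rho by blast
  moreover have "verts R \<inter> I = I" "verts R \<inter> J = J" using IJ by auto
  ultimately have "R = osum S (restriction R I) (restriction R J)"
    unfolding osum_def restriction_def S01 using IJ(1) by (cases R) simp
  then show ?thesis using S by blast
qed

text \<open>Strong induction on the number of points: both sides of a cut are nonempty, hence
  smaller, and they inherit avoidance.\<close>

lemma pattern_free_imp_separable:
  assumes "ordered_binary_structure R" "finite (verts R)" "verts R \<noteq> {}"
    "A_free (slt R) (d R) (verts R)" "B_free (slt R) (d R) (verts R)"
  shows "R \<in> separable_class"
  using assms
proof (induction "card (verts R)" arbitrary: R rule: less_induct)
  case less
  show ?case
  proof (cases "2 \<le> card (verts R)")
    case True
    then obtain I J p where cut: "cut (slt R) (d R) (verts R) I J p"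
      using exists_cut less.prems slt_strict by metis
    have IJ: "I \<noteq> {}" "J \<noteq> {}" "I \<inter> J = {}" "verts R = I \<union> J"
      using cut unfolding cut_def by auto
    have v: "verts (restriction R I) = I" "verts (restriction R J) = J"
      using IJ by (auto simp: restriction_def)
    have "card I < card (verts R)" "card J < card (verts R)"
      using IJ less.prems(2) by (auto intro!: psubset_card_mono)
    moreover have "finite I" "finite J" using IJ less.prems(2) by auto
    ultimately have "restriction R I \<in> separable_class" "restriction R J \<in> separable_class"
      using less.hyps[of "restriction R I"] less.hyps[of "restriction R J"] IJ(1,2)
        restriction_ordered[OF less.prems(1)] pattern_free_restriction[OF less.prems(4,5), of I]
        pattern_free_restriction[OF less.prems(4,5), of J]
      unfolding v by blast+
    then show ?thesis
      using osum_restriction_cut[OF less.prems(1) cut] separable_class.sum v IJ(3) by metis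
  next
    case False
    moreover have "card (verts R) \<noteq> 0" using less.prems by simp
    ultimately have "card (verts R) = 1" by linarith
    then obtain x where "verts R = {x}" by (auto simp: card_1_singleton_iff)
    then show ?thesis by (rule separable_class.one[OF less.prems(1)])
  qed
qed

section \<open>Pattern-freeness of separable structures\<close>

lemma ordered_osum:
  assumes "ordered_binary_structure R1" "ordered_binary_structure R2" "verts R1 \<inter> verts R2 = {}"
  shows "ordered_binary_structure (osum S R1 R2)"
proof -
  have 1: "le R1 \<subseteq> verts R1 \<times> verts R1" "le R2 \<subseteq> verts R2 \<times> verts R2"
    "trans (le R1)" "trans (le R2)" "antisym (le R1)" "antisym (le R2)"
    "total_on (verts R1) (le R1)" "total_on (verts R2) (le R2)"
    "refl_on (verts R1) (le R1)" "refl_on (verts R2) (le R2)"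
    "rho R1 \<subseteq> verts R1 \<times> verts R1" "rho R2 \<subseteq> verts R2 \<times> verts R2"
    using assms unfolding ordered_binary_structure_def order_on_defs by auto
  let ?L = "le R1 \<union> le R2 \<union> verts R1 \<times> verts R2"
  have "trans ?L"
    by (rule transI) (use 1(1-4) assms(3) in \<open>blast dest: transD\<close>)
  moreover have "antisym ?L"
    by (rule antisymI) (use 1(1,2,5,6) assms(3) in \<open>blast dest: antisymD\<close>)
  moreover have "total_on (verts R1 \<union> verts R2) ?L"
    using 1(7,8) by (auto simp: total_on_def)
  moreover have "refl_on (verts R1 \<union> verts R2) ?L" "?L \<subseteq> (verts R1 \<union> verts R2) \<times> (verts R1 \<union> verts R2)"
    using 1(1,2,9,10) by (auto simp: refl_on_def)
  ultimately show ?thesis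
    using 1(11,12) unfolding ordered_binary_structure_def osum_def order_on_defs by auto
qed

text \<open>A chain inside one part is handled by that part. For a chain that crosses the cut,
  enough of its pairs have the single colour \<open>p\<close> to exclude both patterns.\<close>

lemma pattern_free_cut:
  assumes irr: "trans s" "irrefl s" and cut: "cut s c V I J p"
    and I: "A_free s c I" "B_free s c I" and J: "A_free s c J" "B_free s c J"
  shows "A_free s c V" "B_free s c V"
proof -
  have IJ: "V = I \<union> J" "I \<inter> J = {}" and col: "\<And>x y. x \<in> I \<Longrightarrow> y \<in> J \<Longrightarrow> c x y = p"
    and lt: "\<And>x y. x \<in> I \<Longrightarrow> y \<in> J \<Longrightarrow> (x, y) \<in> s"
    using cut unfolding cut_def by auto
  \<comment> \<open>If \<open>y\<close> were in \<open>I\<close>, the cut would put \<open>y\<close>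
    below \<open>x\<close>, closing a cycle in the strict order.\<close>
  have up: "y \<in> J" if "x \<in> J" "(x, y) \<in> s" "y \<in> V" for x y
    using that lt IJ irr by (metis UnE irrefl_def transD)
  have down: "x \<in> I" if "y \<in> I" "(x, y) \<in> s" "x \<in> V" for x y
    using that lt IJ irr by (metis UnE irrefl_def transD)
  show "A_free s c V"
    unfolding A_free_def
  proof (intro ballI impI)
    fix x y z assume V: "x \<in> V" "y \<in> V" "z \<in> V" and s: "(x, y) \<in> s" "(y, z) \<in> s"
    consider "z \<in> I" | "x \<in> J" | "x \<in> I" "z \<in> J" using V IJ by blast
    then show "c x z = c x y \<or> c x z = c y z"
    proof cases
      case 1
      then have "x \<in> I" "y \<in> I" using down V s by blast+
      then show ?thesis using 1 I(1) s unfolding A_free_def by blast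
    next
      case 2
      then have "y \<in> J" "z \<in> J" using up V s by blast+
      then show ?thesis using 2 J(1) s unfolding A_free_def by blast
    next
      case 3
      \<comment> \<open>The outer pair has colour \<open>p\<close>, and so does the inner pair that
        crosses the cut, on whichever side \<open>y\<close> lies.\<close>
      then show ?thesis using V(2) IJ col by (metis UnE)
    qed
  qed
  show "B_free s c V"
    unfolding B_free_def
  proof (intro ballI impI)
    fix w x y z assume V: "w \<in> V" "x \<in> V" "y \<in> V" "z \<in> V"
      and s: "(w, x) \<in> s" "(x, y) \<in> s" "(y, z) \<in> s"
      and c: "c w x = c w z" "c w z = c y z" "c x y = c x z" "c x z = c w y"
    consider "z \<in> I" | "w \<in> J" | "w \<in> I" "x \<in> I" "z \<in> J" | "w \<in> I" "x \<in> J"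
      using V IJ by blast
    then show "c w x = c w y"
    proof cases
      case 1
      then have "w \<in> I" "x \<in> I" "y \<in> I" using down V s by blast+
      then show ?thesis using 1 I(2) s c unfolding B_free_def by blast
    next
      case 2
      then have "x \<in> J" "y \<in> J" "z \<in> J" using up V s by blast+
      then show ?thesis using 2 J(2) s c unfolding B_free_def by blast
    next
      case 3
      \<comment> \<open>Both \<open>c w z\<close> and \<open>c x z\<close> are \<open>p\<close>, and
        the colour premises carry this over to \<open>c w x\<close> and \<open>c w y\<close>,
        wherever \<open>y\<close> lies.\<close>
      then show ?thesis using c col by simp
    next
      case 4
      then have "y \<in> J" using up V s by blast
      then show ?thesis using 4 col by simp
    qed
  qed
qed

text \<open>Induction over the generation of the class. Being ordered, finite and nonempty is
  carried along, because the comparison with \<open>Forb\<close> requires it.\<close>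

lemma separable_imp_pattern_free:
  assumes "R \<in> separable_class"
  shows "ordered_binary_structure R \<and> finite (verts R) \<and> verts R \<noteq> {} \<and>
    A_free (slt R) (d R) (verts R) \<and> B_free (slt R) (d R) (verts R)"
  using assms
proof induction
  case (one R x)
  then show ?case by (auto simp: A_free_def B_free_def)
next
  case (sum R1 R2 S)
  let ?R = "osum S R1 R2"
  have o: "ordered_binary_structure ?R" using sum ordered_osum by blast
  have v: "verts ?R = verts R1 \<union> verts R2" by (simp add: osum_def)
  have sub: "slt R1 \<subseteq> verts R1 \<times> verts R1" "slt R2 \<subseteq> verts R2 \<times> verts R2"
    "rho R1 \<subseteq> verts R1 \<times> verts R1" "rho R2 \<subseteq> verts R2 \<times> verts R2"
    using sum.IH slt_strict(4) unfolding ordered_binary_structure_def by metis+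
  \<comment> \<open>Disjointness keeps the cross pairs of the sum and the pairs of the other summand
    away from pairs inside this one.\<close>
  have 1: "((x, y) \<in> slt ?R \<longleftrightarrow> (x, y) \<in> slt R1) \<and> d ?R x y = d R1 x y"
    if "x \<in> verts R1" "y \<in> verts R1" for x y
    using that sub sum.hyps(3) by (auto simp: osum_def d_def)
  have 2: "((x, y) \<in> slt ?R \<longleftrightarrow> (x, y) \<in> slt R2) \<and> d ?R x y = d R2 x y"
    if "x \<in> verts R2" "y \<in> verts R2" for x y
    using that sub sum.hyps(3) by (auto simp: osum_def d_def)
  have "cut (slt ?R) (d ?R) (verts ?R) (verts R1) (verts R2) ((0, 1) \<in> rho S, (1, 0) \<in> rho S)"
    using sum sub by (auto simp: cut_def v) (auto simp: osum_def d_def)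
  moreover have "A_free (slt ?R) (d ?R) (verts R1)" "B_free (slt ?R) (d ?R) (verts R1)"
    using sum.IH(1) A_free_cong[of "verts R1" "\<lambda>x. x", OF 1] B_free_cong[of "verts R1" "\<lambda>x. x", OF 1]
    by simp_all
  moreover have "A_free (slt ?R) (d ?R) (verts R2)" "B_free (slt ?R) (d ?R) (verts R2)"
    using sum.IH(2) A_free_cong[of "verts R2" "\<lambda>x. x", OF 2] B_free_cong[of "verts R2" "\<lambda>x. x", OF 2]
    by simp_all
  ultimately show ?case
    using o v sum.IH pattern_free_cut slt_strict(1,2)[OF o] by (metis Un_empty finite_UnI)
next
  case (iso R R')
  obtain f where f: "bij_betw f (verts R) (verts R')"
    and fi: "\<And>x y. x \<in> verts R \<Longrightarrow> y \<in> verts R \<Longrightarrow>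
      ((x, y) \<in> le R \<longleftrightarrow> (f x, f y) \<in> le R') \<and> ((x, y) \<in> rho R \<longleftrightarrow> (f x, f y) \<in> rho R')"
    using iso.hyps unfolding isomorphic_def by blast
  have im: "verts R' = f ` verts R" and inj: "inj_on f (verts R)" using f by (auto simp: bij_betw_def)
  \<comment> \<open>Injectivity of \<open>f\<close> lets the correspondence of \<open>le\<close>
    descend to its strict part.\<close>
  have 1: "((f x, f y) \<in> slt R' \<longleftrightarrow> (x, y) \<in> slt R) \<and> d R' (f x) (f y) = d R x y"
    if "x \<in> verts R" "y \<in> verts R" for x y
    using fi[OF that] fi[OF that(2,1)] inj_on_eq_iff[OF inj that] by (simp add: d_def)
  show ?case
    using iso A_free_cong[of "verts R" f, OF 1] B_free_cong[of "verts R" f, OF 1]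
    by (simp add: im)
qed

theorem theorem4p9:
  shows "(\<forall>R :: 'a obs. ordered_binary_structure R \<and> finite (verts R) \<and> verts R \<noteq> {} \<longrightarrow>
            (R \<in> separable_class \<longleftrightarrow> \<not> (\<exists>S \<in> class_A \<union> class_B. embeds_in S R)))
       \<and> (separable_class :: 'a obs set) = {R \<in> Forb (class_A \<union> class_B). verts R \<noteq> {}}"
proof -
  have free: "\<not> (\<exists>S \<in> class_A \<union> class_B. embeds_in S R) \<longleftrightarrow>
      A_free (slt R) (d R) (verts R) \<and> B_free (slt R) (d R) (verts R)"
    if "ordered_binary_structure R" for R :: "'a obs"
    using embeds_class_A_iff[OF that] embeds_class_B_iff[OF that] by blast
  have "R \<in> separable_class \<longleftrightarrow> \<not> (\<exists>S \<in> class_A \<union> class_B. embeds_in S R)"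
    if "ordered_binary_structure R" "finite (verts R)" "verts R \<noteq> {}" for R :: "'a obs"
    unfolding free[OF that(1)] using that pattern_free_imp_separable separable_imp_pattern_free by blast
  \<comment> \<open>The equivalence covers only finite nonempty ordered structures, so the set
    equality also requires that every separable structure is of this kind.\<close>
  moreover have "ordered_binary_structure R" "finite (verts R)" "verts R \<noteq> {}"
    if "R \<in> separable_class" for R :: "'a obs"
    using separable_imp_pattern_free[OF that] by blast+
  ultimately show ?thesis unfolding Forb_def by blast
qed

end
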